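(* Assume that the compact action space $A\subseteq\mathbb{R}^M$ is convex. Let $\pi=(\pi_0,\dots,\pi_{n-1})$ be a locally minimum control policy of DP, and let $(u_0^*,\dots,u_{n-1}^* )$ and $(x_0^*,\dots,x_n^* )$ be the input and state sequences induced by $\pi$ from the initial state $x_0$. Suppose that for all $k\in\{0,\dots,n-1\}$, $\pi_k$ is twice continuously differentiable in a neighborhood of $x_k^*$ and $\nabla_u^2 Q_k^\pi(x_k^*,u_k^* )\succ 0$. Then $(u_0^*,\dots,u_{n-1}^* )$ is a local minimizer of the one-shot problem. Moreover, if $\pi$ is a spurious locally minimum control policy of DP, then $(u_0^*,\dots,u_{n-1}^* )$ is a spurious local minimizer of the one-shot problem.
   Context: Setting (deterministic optimal control): horizon $n$, states in $\mathbb{R}^N$, compact action space $A\subseteq\mathbb{R}^M$, dynamics $f_k:\mathbb{R}^N\times\mathbb{R}^M\to\mathbb{R}^N$ and stage costs $c_k:\mathbb{R}^N\times\mathbb{R}^M\to\mathbb{R}$ ($k=0,\dots,n-1$), terminal cost $c_n:\mathbb{R}^N\to\mathbb{R}$, all at least twice continuously differentiable; the initial state $x_0$ is given. $B(c,r)$ denotes the open ball with center $c$ and radius $r$. Cost of an input sequence: $C(x)=c_n(x)$ (no inputs), and $C(x;u_k,\dots,u_{n-1})=c_k(x,u_k)+C(f_k(x,u_k);u_{k+1},\dots,u_{n-1})$. The one-shot problem is $\min_{u_0,\dots,u_{n-1}\in A}C(x_0;u_0,\dots,u_{n-1})$, with optimal value denoted $J_0(x_0)$. A control policy is $\pi=(\pi_0,\dots,\pi_{n-1})$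 with $\pi_k:\mathbb{R}^N\to A$. Its Q-functions and cost-to-go functions are defined backward by $J_n^\pi(x)=c_n(x)$, $Q_k^\pi(x,u)=c_k(x,u)+J_{k+1}^\pi(f_k(x,u))$, $J_k^\pi(x)=Q_k^\pi(x,\pi_k(x))$, $k=n-1,\dots,0$. The induced sequences from $x_0$ are $x_0^*=x_0$, $u_k^*=\pi_k(x_k^* )$, $x_{k+1}^*=f_k(x_k^*,u_k^* )$. Local minimizer of the one-shot problem: $(u_0^*,\dots,u_{n-1}^* )\in A^n$ such that for some $\epsilon>0$, $C(x_0;u_0^*,\dots,u_{n-1}^* )\le C(x_0;\tilde u_0,\dots,\tilde u_{n-1})$ for all $\tilde u_i\in B(u_i^*,\epsilon)\cap A$, $i=0,\dots,n-1$. It is spurious if $C(x_0;u_0^*,\dots,u_{n-1}^* )>J_0(x_0)$. Locally minimum control policy of DP: $\pi$ such that for all $k\in\{0,\dots,n-1\}$ and all $x\in\mathbb{R}^N$ there is $\epsilon_k^*(x)>0$ with $Q_k^\pi(x,\pi_k(x))\le Q_k^\pi(x,\tilde u)$ for all $\tilde u\in B(\pi_k(x),\epsilon_k^*(x))\cap A$. It is spurious if $J_0^\pi(x_0)>J_0(x_0)$. *)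

theory Defs
  imports "HOL-Analysis.Analysis"
begin

text \<open>Only meaningful for open \<open>S\<close>. The domain may be a product space, which gives joint
  smoothness in several variables.\<close>

definition twice_cont_diff_on ::
    "('a::real_normed_vector \<Rightarrow> 'b::real_normed_vector) \<Rightarrow> 'a set \<Rightarrow> bool" where
  "twice_cont_diff_on g S \<longleftrightarrow>
    (\<exists>g' :: 'a \<Rightarrow> 'a \<Rightarrow>\<^sub>L 'b. \<exists>g'' :: 'a \<Rightarrow> 'a \<Rightarrow>\<^sub>L ('a \<Rightarrow>\<^sub>L 'b).
      (\<forall>x\<in>S. (g has_derivative blinfun_apply (g' x)) (at x)) \<and>
      (\<forall>x\<in>S. (g' has_derivative blinfun_apply (g'' x)) (at x)) \<and>
      continuous_on S g'')"

definition gradient :: "('a::real_inner \<Rightarrow> real) \<Rightarrow> 'a \<Rightarrow> 'a" where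
  "gradient g x = (THE D. GDERIV g x :> D)"

text \<open>Like \<open>gradient\<close>, this is an unspecified value where the derivatives fail to exist.\<close>

definition hessian :: "(real^'m \<Rightarrow> real) \<Rightarrow> real^'m \<Rightarrow> real^'m^'m" where
  "hessian g x = jacobian (gradient g) (at x)"

definition pos_definite :: "real^'m^'m \<Rightarrow> bool" where
  "pos_definite H \<longleftrightarrow> transpose H = H \<and> (\<forall>v. v \<noteq> 0 \<longrightarrow> v \<bullet> (H *v v) > 0)"

text \<open>Throughout, \<open>n\<close> is the horizon, \<open>A\<close> the action space, \<open>f k\<close> and \<open>c k\<close> are the dynamics and the
  cost of stage \<open>k < n\<close>, \<open>cT\<close> is the terminal cost and \<open>\<pi> k\<close> the policy of stage \<open>k < n\<close>; the values
  of \<open>f\<close>, \<open>c\<close> and \<open>\<pi>\<close> at stages \<open>k \<ge> n\<close> are irrelevant.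

  In \<open>seq_cost f c cT k x us\<close> the list \<open>us\<close> holds the inputs of stages \<open>k, \<dots>, n - 1\<close>, so its length
  is meant to be \<open>n - k\<close>.\<close>

fun seq_cost ::
    "(nat \<Rightarrow> 's \<Rightarrow> 'u \<Rightarrow> 's) \<Rightarrow> (nat \<Rightarrow> 's \<Rightarrow> 'u \<Rightarrow> real) \<Rightarrow> ('s \<Rightarrow> real) \<Rightarrow>
      nat \<Rightarrow> 's \<Rightarrow> 'u list \<Rightarrow> real" where
  "seq_cost f c cT k x [] = cT x"
| "seq_cost f c cT k x (u # us) = c k x u + seq_cost f c cT (Suc k) (f k x u) us"

definition input_seqs :: "nat \<Rightarrow> 'u set \<Rightarrow> 'u list set" where
  "input_seqs n A = {us. length us = n \<and> set us \<subseteq> A}"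

text \<open>The infimum is a minimum when \<open>A\<close> is compact and nonempty and the data are continuous.\<close>

definition opt_value ::
    "nat \<Rightarrow> 'u set \<Rightarrow> (nat \<Rightarrow> 's \<Rightarrow> 'u \<Rightarrow> 's) \<Rightarrow> (nat \<Rightarrow> 's \<Rightarrow> 'u \<Rightarrow> real) \<Rightarrow> ('s \<Rightarrow> real) \<Rightarrow>
      's \<Rightarrow> real" where
  "opt_value n A f c cT x0 = (INF us\<in>input_seqs n A. seq_cost f c cT 0 x0 us)"

definition one_shot_local_min ::
    "nat \<Rightarrow> 'u::metric_space set \<Rightarrow> (nat \<Rightarrow> 's \<Rightarrow> 'u \<Rightarrow> 's) \<Rightarrow> (nat \<Rightarrow> 's \<Rightarrow> 'u \<Rightarrow> real) \<Rightarrow>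
      ('s \<Rightarrow> real) \<Rightarrow> 's \<Rightarrow> 'u list \<Rightarrow> bool" where
  "one_shot_local_min n A f c cT x0 us \<longleftrightarrow>
    us \<in> input_seqs n A \<and>
    (\<exists>\<epsilon>>0. \<forall>vs. length vs = n \<and> (\<forall>i<n. vs ! i \<in> ball (us ! i) \<epsilon> \<inter> A) \<longrightarrow>
      seq_cost f c cT 0 x0 us \<le> seq_cost f c cT 0 x0 vs)"

definition spurious_one_shot_local_min ::
    "nat \<Rightarrow> 'u::metric_space set \<Rightarrow> (nat \<Rightarrow> 's \<Rightarrow> 'u \<Rightarrow> 's) \<Rightarrow> (nat \<Rightarrow> 's \<Rightarrow> 'u \<Rightarrow> real) \<Rightarrow>
      ('s \<Rightarrow> real) \<Rightarrow> 's \<Rightarrow> 'u list \<Rightarrow> bool" where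
  "spurious_one_shot_local_min n A f c cT x0 us \<longleftrightarrow>
    one_shot_local_min n A f c cT x0 us \<and>
    seq_cost f c cT 0 x0 us > opt_value n A f c cT x0"

function (sequential)
  cost_to_go ::
    "nat \<Rightarrow> (nat \<Rightarrow> 's \<Rightarrow> 'u \<Rightarrow> 's) \<Rightarrow> (nat \<Rightarrow> 's \<Rightarrow> 'u \<Rightarrow> real) \<Rightarrow> ('s \<Rightarrow> real) \<Rightarrow>
      (nat \<Rightarrow> 's \<Rightarrow> 'u) \<Rightarrow> nat \<Rightarrow> 's \<Rightarrow> real" and
  Q_fun ::
    "nat \<Rightarrow> (nat \<Rightarrow> 's \<Rightarrow> 'u \<Rightarrow> 's) \<Rightarrow> (nat \<Rightarrow> 's \<Rightarrow> 'u \<Rightarrow> real) \<Rightarrow> ('s \<Rightarrow> real) \<Rightarrow>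
      (nat \<Rightarrow> 's \<Rightarrow> 'u) \<Rightarrow> nat \<Rightarrow> 's \<Rightarrow> 'u \<Rightarrow> real" where
  "cost_to_go n f c cT \<pi> k x = (if k < n then Q_fun n f c cT \<pi> k x (\<pi> k x) else cT x)"
| "Q_fun n f c cT \<pi> k x u = c k x u + cost_to_go n f c cT \<pi> (Suc k) (f k x u)"
  by pat_completeness auto
termination
  by (relation "Wellfounded.measure (\<lambda>a. case a of
      Inl (n, f, c, cT, \<pi>, k, x) \<Rightarrow> 2 * (n - k)
    | Inr (n, f, c, cT, \<pi>, k, x, u) \<Rightarrow> Suc (2 * (n - Suc k)))") auto

declare cost_to_go.simps [simp del] Q_fun.simps [simp del]

fun induced_state :: "(nat \<Rightarrow> 's \<Rightarrow> 'u \<Rightarrow> 's) \<Rightarrow> (nat \<Rightarrow> 's \<Rightarrow> 'u) \<Rightarrow> 's \<Rightarrow> nat \<Rightarrow> 's" where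
  "induced_state f \<pi> x0 0 = x0"
| "induced_state f \<pi> x0 (Suc k) =
    f k (induced_state f \<pi> x0 k) (\<pi> k (induced_state f \<pi> x0 k))"

definition induced_input :: "(nat \<Rightarrow> 's \<Rightarrow> 'u \<Rightarrow> 's) \<Rightarrow> (nat \<Rightarrow> 's \<Rightarrow> 'u) \<Rightarrow> 's \<Rightarrow> nat \<Rightarrow> 'u" where
  "induced_input f \<pi> x0 k = \<pi> k (induced_state f \<pi> x0 k)"

definition induced_inputs ::
    "nat \<Rightarrow> (nat \<Rightarrow> 's \<Rightarrow> 'u \<Rightarrow> 's) \<Rightarrow> (nat \<Rightarrow> 's \<Rightarrow> 'u) \<Rightarrow> 's \<Rightarrow> 'u list" where
  "induced_inputs n f \<pi> x0 = map (induced_input f \<pi> x0) [0..<n]"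

definition control_policy :: "nat \<Rightarrow> 'u set \<Rightarrow> (nat \<Rightarrow> 's \<Rightarrow> 'u) \<Rightarrow> bool" where
  "control_policy n A \<pi> \<longleftrightarrow> (\<forall>k<n. \<forall>x. \<pi> k x \<in> A)"

definition locally_min_policy ::
    "nat \<Rightarrow> 'u::metric_space set \<Rightarrow> (nat \<Rightarrow> 's \<Rightarrow> 'u \<Rightarrow> 's) \<Rightarrow> (nat \<Rightarrow> 's \<Rightarrow> 'u \<Rightarrow> real) \<Rightarrow>
      ('s \<Rightarrow> real) \<Rightarrow> (nat \<Rightarrow> 's \<Rightarrow> 'u) \<Rightarrow> bool" where
  "locally_min_policy n A f c cT \<pi> \<longleftrightarrow>
    control_policy n A \<pi> \<and>
    (\<forall>k<n. \<forall>x. \<exists>\<epsilon>>0. \<forall>u \<in> ball (\<pi> k x) \<epsilon> \<inter> A.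
      Q_fun n f c cT \<pi> k x (\<pi> k x) \<le> Q_fun n f c cT \<pi> k x u)"

definition spurious_locally_min_policy ::
    "nat \<Rightarrow> 'u::metric_space set \<Rightarrow> (nat \<Rightarrow> 's \<Rightarrow> 'u \<Rightarrow> 's) \<Rightarrow> (nat \<Rightarrow> 's \<Rightarrow> 'u \<Rightarrow> real) \<Rightarrow>
      ('s \<Rightarrow> real) \<Rightarrow> 's \<Rightarrow> (nat \<Rightarrow> 's \<Rightarrow> 'u) \<Rightarrow> bool" where
  "spurious_locally_min_policy n A f c cT x0 \<pi> \<longleftrightarrow>
    locally_min_policy n A f c cT \<pi> \<and>
    cost_to_go n f c cT \<pi> 0 x0 > opt_value n A f c cT x0"

end

theory Submission
  imports Defs
begin

text \<open>Backward in time, \<open>J\<^sub>k\<close> is twice continuously differentiable near \<open>x\<^sub>k\<^sup>*\<close> and \<open>Q\<^sub>k\<close> near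
  \<open>(x\<^sub>k\<^sup>*, u\<^sub>k\<^sup>*)\<close>. By continuity of the second derivative, positive definiteness of the Hessian at
  that point makes \<open>Q\<^sub>k(x, \<cdot>)\<close> convex on a ball around \<open>u\<^sub>k\<^sup>*\<close> whose radius does not depend on \<open>x\<close>
  near \<open>x\<^sub>k\<^sup>*\<close>. Hence the local minimizer \<open>\<pi>\<^sub>k(x)\<close>, whose own radius \<open>\<epsilon>\<^sub>k\<^sup>*(x)\<close> may shrink as \<open>x\<close>
  varies, minimizes \<open>Q\<^sub>k(x, \<cdot>)\<close> over the whole intersection of that ball with the convex set \<open>A\<close>.
  Chaining the resulting inequalities \<open>J\<^sub>k(x) \<le> Q\<^sub>k(x, u)\<close> along a perturbed trajectory gives
  the claim.\<close>

section \<open>Closure properties of twice continuous differentiability\<close>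

text \<open>This layer turns twice continuous differentiability into "the derivative map is
  \<open>cont_diff_on\<close>", so each second-order closure property follows from a first-order one
  applied to the derivative.\<close>

definition cont_diff_on ::
    "('a::real_normed_vector \<Rightarrow> 'b::real_normed_vector) \<Rightarrow> 'a set \<Rightarrow> bool" where
  "cont_diff_on g S \<longleftrightarrow>
    (\<exists>g' :: 'a \<Rightarrow> 'a \<Rightarrow>\<^sub>L 'b.
      (\<forall>x\<in>S. (g has_derivative blinfun_apply (g' x)) (at x)) \<and> continuous_on S g')"

lemma twice_cont_diff_on_iff:
  "twice_cont_diff_on g S \<longleftrightarrow>
    (\<exists>g'. (\<forall>x\<in>S. (g has_derivative blinfun_apply (g' x)) (at x)) \<and> cont_diff_on g' S)"
  unfolding twice_cont_diff_on_def cont_diff_on_def by blast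

lemma cont_diff_onI:
  assumes "\<And>x. x \<in> S \<Longrightarrow> (g has_derivative blinfun_apply (g' x)) (at x)"
    and "continuous_on S g'"
  shows "cont_diff_on g S"
  unfolding cont_diff_on_def using assms by (intro exI[of _ g']) simp

lemma twice_cont_diff_onI:
  assumes "\<And>x. x \<in> S \<Longrightarrow> (g has_derivative blinfun_apply (g' x)) (at x)"
    and "cont_diff_on g' S"
  shows "twice_cont_diff_on g S"
  unfolding twice_cont_diff_on_iff using assms by (intro exI[of _ g']) simp

lemma cont_diff_onE:
  assumes "cont_diff_on g S"
  obtains g' where "\<And>x. x \<in> S \<Longrightarrow> (g has_derivative blinfun_apply (g' x)) (at x)"
    and "continuous_on S g'"
  using assms unfolding cont_diff_on_def by blast

lemma twice_cont_diff_onE: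
  assumes "twice_cont_diff_on g S"
  obtains g' where "\<And>x. x \<in> S \<Longrightarrow> (g has_derivative blinfun_apply (g' x)) (at x)"
    and "cont_diff_on g' S"
  using assms unfolding twice_cont_diff_on_iff by blast

lemma cont_diff_on_imp_continuous_on:
  assumes "cont_diff_on g S"
  shows "continuous_on S g"
  by (rule cont_diff_onE[OF assms])
    (blast intro: continuous_at_imp_continuous_on has_derivative_continuous)

lemma twice_cont_diff_on_imp_cont_diff_on:
  assumes "twice_cont_diff_on g S"
  shows "cont_diff_on g S"
  by (rule twice_cont_diff_onE[OF assms]) (rule cont_diff_onI[OF _ cont_diff_on_imp_continuous_on])

lemma twice_cont_diff_on_imp_continuous_on: "twice_cont_diff_on g S \<Longrightarrow> continuous_on S g"
  by (simp add: cont_diff_on_imp_continuous_on twice_cont_diff_on_imp_cont_diff_on)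

lemma cont_diff_on_subset:
  assumes "cont_diff_on g T" and "S \<subseteq> T"
  shows "cont_diff_on g S"
  by (rule cont_diff_onE[OF assms(1)])
    (use assms(2) in \<open>auto intro!: cont_diff_onI intro: continuous_on_subset\<close>)

lemma twice_cont_diff_on_subset:
  assumes "twice_cont_diff_on g T" and "S \<subseteq> T"
  shows "twice_cont_diff_on g S"
  by (rule twice_cont_diff_onE[OF assms(1)])
    (use assms(2) in \<open>auto intro!: twice_cont_diff_onI intro: cont_diff_on_subset\<close>)

lemma cont_diff_on_const: "cont_diff_on (\<lambda>_. a) S"
  by (rule cont_diff_onI[of _ _ "\<lambda>_. 0"]) (auto simp: zero_blinfun.rep_eq)

lemma twice_cont_diff_on_linear:
  assumes "bounded_linear g"
  shows "twice_cont_diff_on g S"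
  by (rule twice_cont_diff_onI[of _ _ "\<lambda>_. Blinfun g"])
    (simp_all add: assms bounded_linear_Blinfun_apply bounded_linear_imp_has_derivative cont_diff_on_const)

lemma cont_diff_on_add:
  assumes "cont_diff_on g S" and "cont_diff_on h S"
  shows "cont_diff_on (\<lambda>x. g x + h x) S"
proof -
  obtain g' where g': "\<And>x. x \<in> S \<Longrightarrow> (g has_derivative blinfun_apply (g' x)) (at x)"
    "continuous_on S g'" by (rule cont_diff_onE[OF assms(1)]) (rule that)
  obtain h' where h': "\<And>x. x \<in> S \<Longrightarrow> (h has_derivative blinfun_apply (h' x)) (at x)"
    "continuous_on S h'" by (rule cont_diff_onE[OF assms(2)]) (rule that)
  show ?thesis
    by (rule cont_diff_onI[of _ _ "\<lambda>x. g' x + h' x"])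
      (simp_all add: g' h' plus_blinfun.rep_eq[abs_def] has_derivative_add continuous_on_add)
qed

lemma twice_cont_diff_on_add:
  assumes "twice_cont_diff_on g S" and "twice_cont_diff_on h S"
  shows "twice_cont_diff_on (\<lambda>x. g x + h x) S"
proof -
  obtain g' where g': "\<And>x. x \<in> S \<Longrightarrow> (g has_derivative blinfun_apply (g' x)) (at x)"
    "cont_diff_on g' S" by (rule twice_cont_diff_onE[OF assms(1)]) (rule that)
  obtain h' where h': "\<And>x. x \<in> S \<Longrightarrow> (h has_derivative blinfun_apply (h' x)) (at x)"
    "cont_diff_on h' S" by (rule twice_cont_diff_onE[OF assms(2)]) (rule that)
  show ?thesis
    by (rule twice_cont_diff_onI[of _ _ "\<lambda>x. g' x + h' x"])
      (simp_all add: g' h' plus_blinfun.rep_eq[abs_def] has_derivative_add cont_diff_on_add)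
qed

text \<open>The product rule. It is meant for \<open>B\<close> the composition
  \<open>o\<^sub>L\<close> of bounded linear maps, which occurs in the derivative of a
  composition.\<close>

lemma cont_diff_on_bilinear:
  assumes "bounded_bilinear B" and "cont_diff_on g S" and "cont_diff_on h S"
  shows "cont_diff_on (\<lambda>x. B (g x) (h x)) S"
proof -
  interpret B: bounded_bilinear B by fact
  obtain g' where g': "\<And>x. x \<in> S \<Longrightarrow> (g has_derivative blinfun_apply (g' x)) (at x)"
    "continuous_on S g'" by (rule cont_diff_onE[OF assms(2)]) (rule that)
  obtain h' where h': "\<And>x. x \<in> S \<Longrightarrow> (h has_derivative blinfun_apply (h' x)) (at x)"
    "continuous_on S h'" by (rule cont_diff_onE[OF assms(3)]) (rule that)
  have "continuous_on S g" "continuous_on S h"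
    using assms by (auto intro: cont_diff_on_imp_continuous_on)
  \<comment> \<open>The derivative \<open>v \<mapsto> B (g x) (h' x v) + B (g' x v) (h x)\<close> is
    written as a sum of bounded linear maps, so that its continuity in \<open>x\<close> for the
    operator norm follows from that of its ingredients.\<close>
  then have "continuous_on S (\<lambda>x. (B.prod_right (g x) o\<^sub>L h' x) + (B.prod_left (h x) o\<^sub>L g' x))"
    using g'(2) h'(2)
    by (intro continuous_intros bounded_bilinear.continuous_on[OF bounded_bilinear_blinfun_compose]
        bounded_linear.continuous_on[OF B.bounded_linear_prod_right]
        bounded_linear.continuous_on[OF B.bounded_linear_prod_left])
  moreover have "((\<lambda>x. B (g x) (h x)) has_derivative
      blinfun_apply ((B.prod_right (g x) o\<^sub>L h' x) + (B.prod_left (h x) o\<^sub>L g' x))) (at x)"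
    if "x \<in> S" for x
    using B.FDERIV[OF g'(1)[OF that] h'(1)[OF that]]
    by (simp add: plus_blinfun.rep_eq B.prod_right.rep_eq B.prod_left.rep_eq)
  ultimately show ?thesis by (intro cont_diff_onI)
qed

lemma cont_diff_on_compose:
  assumes "cont_diff_on g T" and "cont_diff_on h S" and "h ` S \<subseteq> T"
  shows "cont_diff_on (\<lambda>x. g (h x)) S"
proof -
  obtain g' where g': "\<And>x. x \<in> T \<Longrightarrow> (g has_derivative blinfun_apply (g' x)) (at x)"
    "continuous_on T g'" by (rule cont_diff_onE[OF assms(1)]) (rule that)
  obtain h' where h': "\<And>x. x \<in> S \<Longrightarrow> (h has_derivative blinfun_apply (h' x)) (at x)"
    "continuous_on S h'" by (rule cont_diff_onE[OF assms(2)]) (rule that)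
  have "continuous_on S (\<lambda>x. g' (h x))"
    using continuous_on_compose2[OF g'(2) cont_diff_on_imp_continuous_on] assms by blast
  then have "continuous_on S (\<lambda>x. g' (h x) o\<^sub>L h' x)"
    by (rule bounded_bilinear.continuous_on[OF bounded_bilinear_blinfun_compose]) (rule h')
  moreover have "((\<lambda>x. g (h x)) has_derivative blinfun_apply (g' (h x) o\<^sub>L h' x)) (at x)"
    if "x \<in> S" for x
    using has_derivative_compose[OF h'(1)[OF that] g'(1)] that assms(3)
    by (simp add: image_subset_iff blinfun_compose.rep_eq o_def)
  ultimately show ?thesis by (intro cont_diff_onI)
qed

text \<open>The derivative \<open>g' (h x) o\<^sub>L h' x\<close> is a bilinear expression in two
  continuously differentiable maps: the first-order chain rule handles \<open>g' (h x)\<close>, and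
  the product rule handles \<open>o\<^sub>L\<close>.\<close>

lemma twice_cont_diff_on_compose:
  assumes "twice_cont_diff_on g T" and "twice_cont_diff_on h S" and "h ` S \<subseteq> T"
  shows "twice_cont_diff_on (\<lambda>x. g (h x)) S"
proof -
  obtain g' where g': "\<And>x. x \<in> T \<Longrightarrow> (g has_derivative blinfun_apply (g' x)) (at x)"
    "cont_diff_on g' T" by (rule twice_cont_diff_onE[OF assms(1)]) (rule that)
  obtain h' where h': "\<And>x. x \<in> S \<Longrightarrow> (h has_derivative blinfun_apply (h' x)) (at x)"
    "cont_diff_on h' S" by (rule twice_cont_diff_onE[OF assms(2)]) (rule that)
  have "cont_diff_on (\<lambda>x. g' (h x)) S"
    using cont_diff_on_compose[OF g'(2) twice_cont_diff_on_imp_cont_diff_on] assms by blast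
  then have "cont_diff_on (\<lambda>x. g' (h x) o\<^sub>L h' x) S"
    by (rule cont_diff_on_bilinear[OF bounded_bilinear_blinfun_compose]) (rule h')
  moreover have "((\<lambda>x. g (h x)) has_derivative blinfun_apply (g' (h x) o\<^sub>L h' x)) (at x)"
    if "x \<in> S" for x
    using has_derivative_compose[OF h'(1)[OF that] g'(1)] that assms(3)
    by (simp add: image_subset_iff blinfun_compose.rep_eq o_def)
  ultimately show ?thesis by (intro twice_cont_diff_onI)
qed

text \<open>Split \<open>(g x, h x) = (g x, 0) + (0, h x)\<close>; each summand is a bounded linear
  embedding composed with \<open>g\<close> or \<open>h\<close>.\<close>

lemma twice_cont_diff_on_Pair:
  fixes g :: "'a::real_normed_vector \<Rightarrow> 'b::real_normed_vector"
    and h :: "'a \<Rightarrow> 'c::real_normed_vector"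
  assumes "twice_cont_diff_on g S" and "twice_cont_diff_on h S"
  shows "twice_cont_diff_on (\<lambda>x. (g x, h x)) S"
proof -
  have "bounded_linear (\<lambda>y::'b. (y, 0::'c))" "bounded_linear (\<lambda>z::'c. (0::'b, z))"
    by (intro bounded_linear_Pair bounded_linear_ident bounded_linear_zero)+
  then have "twice_cont_diff_on (\<lambda>x. (g x, 0::'c)) S" "twice_cont_diff_on (\<lambda>x. (0::'b, h x)) S"
    using twice_cont_diff_on_compose[OF twice_cont_diff_on_linear[of _ UNIV]] assms by blast+
  from twice_cont_diff_on_add[OF this] show ?thesis by simp
qed

section \<open>Positive definite Hessians and local convexity\<close>

lemma gradient_eqI:
  assumes "GDERIV g x :> D"
  shows "gradient g x = D"
  unfolding gradient_def
proof (rule the_equality)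
  fix E assume "GDERIV g x :> E"
  then have "(\<lambda>h. h \<bullet> E) = (\<lambda>h. h \<bullet> D)"
    using assms has_derivative_unique unfolding gderiv_def by blast
  then show "E = D" using vector_eq_ldot[of E D] by (simp add: fun_eq_iff)
qed fact

text \<open>Links the matrix Hessian, built from \<open>THE\<close> and \<open>jacobian\<close>, to
  the second derivative as a bounded linear map. The Riesz identification of functionals with
  vectors carries \<open>g'\<close> to the gradient, hence \<open>g''\<close> to the derivative of
  the gradient, which the Hessian matrix represents.\<close>

lemma hessian_quadratic_form:
  fixes g :: "real^'m \<Rightarrow> real"
  assumes "open S" and "u \<in> S"
    and g': "\<And>w. w \<in> S \<Longrightarrow> (g has_derivative blinfun_apply (g' w)) (at w)"
    and g'': "(g' has_derivative g'') (at u)"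
  shows "v \<bullet> (hessian g u *v v) = blinfun_apply (g'' v) v"
proof -
  \<comment> \<open>\<open>T\<close> sends a functional to its Riesz representing vector.\<close>
  define T where "T \<phi> = (\<Sum>b\<in>Basis. blinfun_apply \<phi> b *\<^sub>R b)" for \<phi> :: "(real^'m) \<Rightarrow>\<^sub>L real"
  have T: "h \<bullet> T \<phi> = blinfun_apply \<phi> h" for h \<phi>
  proof -
    have "blinfun_apply \<phi> h = blinfun_apply \<phi> (\<Sum>b\<in>Basis. (h \<bullet> b) *\<^sub>R b)"
      by (simp add: euclidean_representation)
    also have "\<dots> = h \<bullet> T \<phi>"
      by (simp add: T_def blinfun.sum_right blinfun.scaleR_right inner_sum_right mult.commute)
    finally show ?thesis by simp
  qed
  have lin: "bounded_linear T"
    unfolding T_def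
    by (intro bounded_linear_sum bounded_linear_scaleR_const blinfun.bounded_linear_left)
  have grad: "T (g' w) = gradient g w" if "w \<in> S" for w
    using g'[OF that] by (intro gradient_eqI[symmetric]) (simp add: gderiv_def T)
  have "((\<lambda>w. T (g' w)) has_derivative (\<lambda>h. T (g'' h))) (at u)"
    by (rule bounded_linear.has_derivative[OF lin g''])
  \<comment> \<open>The gradient agrees with \<open>T (g' w)\<close> on the whole open set
    \<open>S\<close>, not merely at \<open>u\<close>, so the derivative at \<open>u\<close> carries
    over.\<close>
  then have D: "(gradient g has_derivative (\<lambda>h. T (g'' h))) (at u)"
    by (rule has_derivative_transform_within_open) (use assms grad in auto)
  then have "gradient g differentiable (at u)" by (auto simp: differentiable_def)
  then have "(gradient g has_derivative (\<lambda>h. hessian g u *v h)) (at u)"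
    unfolding hessian_def using jacobian_works by blast
  from has_derivative_unique[OF this D] show ?thesis by (metis T)
qed

text \<open>Reduces convexity to functions of one real variable, where the second derivative test is
  available.\<close>

lemma convex_on_segmentsI:
  fixes g :: "'a::real_vector \<Rightarrow> real"
  assumes "convex C"
    and "\<And>u w. u \<in> C \<Longrightarrow> w \<in> C \<Longrightarrow> convex_on {0..1} (\<lambda>t. g (u + t *\<^sub>R (w - u)))"
  shows "convex_on C g"
proof (rule convex_onI)
  fix t u w assume t: "0 < t" "t < (1::real)" and "u \<in> C" "w \<in> C"
  from convex_onD[OF assms(2)[OF \<open>u \<in> C\<close> \<open>w \<in> C\<close>], of t 0 1] t
  have "g (u + t *\<^sub>R (w - u)) \<le> (1 - t) * g u + t * g w" by simp
  moreover have "u + t *\<^sub>R (w - u) = (1 - t) *\<^sub>R u + t *\<^sub>R w" by (simp add: algebra_simps)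
  ultimately show "g ((1 - t) *\<^sub>R u + t *\<^sub>R w) \<le> (1 - t) * g u + t * g w" by simp
qed fact

text \<open>On the compact unit sphere the form attains a minimum, which is positive and serves as
  \<open>m\<close>; homogeneity of degree two extends the bound to all vectors.\<close>

lemma pos_quadratic_form_uniform:
  fixes q :: "'a::euclidean_space \<Rightarrow>\<^sub>L 'a \<Rightarrow>\<^sub>L real"
  assumes "\<And>v. v \<noteq> 0 \<Longrightarrow> 0 < q v v"
  obtains m where "0 < m" and "\<And>v. m * (norm v)\<^sup>2 \<le> q v v"
proof -
  have "continuous_on (sphere 0 1) (\<lambda>v. q v v)"
    by (intro continuous_intros)
  moreover obtain e :: 'a where "norm e = 1" using vector_choose_size[of 1] by auto
  then have "sphere 0 1 \<noteq> ({} :: 'a set)" by auto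
  ultimately obtain e where e: "e \<in> sphere 0 1" "\<And>v. v \<in> sphere 0 1 \<Longrightarrow> q e e \<le> q v v"
    using continuous_attains_inf[of "sphere 0 1" "\<lambda>v. q v v"] by auto
  have "q e e * (norm v)\<^sup>2 \<le> q v v" for v
  proof (cases "v = 0")
    case False
    have "q e e \<le> q (v /\<^sub>R norm v) (v /\<^sub>R norm v)" using False by (intro e) simp
    also have "\<dots> = q v v / (norm v)\<^sup>2"
      by (simp add: blinfun.scaleR_left blinfun.scaleR_right power2_eq_square field_simps)
    finally show ?thesis using False by (simp add: field_simps)
  qed simp
  moreover have "0 < q e e" using e(1) by (intro assms) auto
  ultimately show thesis using that by blast
qed

text \<open>At the base point the second derivative in \<open>u\<close> is bounded below by some
  \<open>m > 0\<close>. It is continuous jointly in \<open>(x, u)\<close>, so near that point it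
  moves by less than \<open>m\<close> in operator norm and stays nonnegative. Joint continuity is
  what gives one radius for all nearby \<open>x\<close>.\<close>

lemma locally_convex_of_pos_definite_hessian:
  fixes Q :: "'s::real_normed_vector \<Rightarrow> real^'m \<Rightarrow> real"
  assumes Q: "twice_cont_diff_on (\<lambda>(x, u). Q x u) W" and W: "open W" "(x0, u0) \<in> W"
    and pd: "pos_definite (hessian (Q x0) u0)"
  obtains r where "0 < r" and "\<And>x. x \<in> ball x0 r \<Longrightarrow> convex_on (ball u0 r) (Q x)"
proof -
  obtain Q' Q'' where Q': "\<And>z. z \<in> W \<Longrightarrow> ((\<lambda>(x, u). Q x u) has_derivative blinfun_apply (Q' z)) (at z)"
    and Q'': "\<And>z. z \<in> W \<Longrightarrow> (Q' has_derivative blinfun_apply (Q'' z)) (at z)"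
    and cont: "continuous_on W Q''"
    using Q unfolding twice_cont_diff_on_def by blast
  \<comment> \<open>\<open>P\<close> embeds control directions into the product space, and
    \<open>R\<close> below restricts functionals on the product to these directions.\<close>
  define P :: "(real^'m) \<Rightarrow>\<^sub>L ('s \<times> (real^'m))" where "P = Blinfun (Pair 0)"
  have P [simp]: "blinfun_apply P v = (0, v)" for v
    unfolding P_def
    by (subst bounded_linear_Blinfun_apply)
      (simp_all add: bounded_linear_Pair bounded_linear_ident bounded_linear_zero)
  define R :: "(('s \<times> (real^'m)) \<Rightarrow>\<^sub>L real) \<Rightarrow>\<^sub>L ((real^'m) \<Rightarrow>\<^sub>L real)"
    where "R = bounded_bilinear.prod_left (o\<^sub>L) P"
  have R [simp]: "blinfun_apply R \<phi> = \<phi> o\<^sub>L P" for \<phi>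
    unfolding R_def bounded_bilinear.prod_left.rep_eq[OF bounded_bilinear_blinfun_compose] ..
  \<comment> \<open>\<open>q z\<close> is the second partial derivative in \<open>u\<close> at
    \<open>z\<close>. Being linear in \<open>Q'' z\<close>, it inherits continuity.\<close>
  define q where "q z = R o\<^sub>L Q'' z o\<^sub>L P" for z
  have q: "blinfun_apply (blinfun_apply (q z) v) v = Q'' z (0, v) (0, v)" for z v
    by (simp add: q_def)
  have pair: "((\<lambda>w. (x, w)) has_derivative (\<lambda>h. (0, h))) (at u)" for x :: 's and u :: "real^'m"
    by (auto intro!: derivative_eq_intros)
  have "(Q x0 has_derivative blinfun_apply (R (Q' (x0, u)))) (at u)"
    if "(x0, u) \<in> W" for u
    using has_derivative_compose[OF pair Q'[OF that]]
    by (simp add: blinfun_compose.rep_eq o_def)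
  moreover have "((\<lambda>w. R (Q' (x0, w))) has_derivative blinfun_apply (q (x0, u0))) (at u0)"
    using bounded_linear.has_derivative[OF blinfun.bounded_linear_right[of R]
        has_derivative_compose[OF pair Q''[OF W(2)]]]
    by (simp add: q_def blinfun_compose.rep_eq o_def)
  moreover have "open ((\<lambda>w. (x0, w)) -` W)"
    using W(1) by (intro continuous_open_vimage) (auto intro!: continuous_intros)
  ultimately have "v \<bullet> (hessian (Q x0) u0 *v v) = q (x0, u0) v v" for v
    using W(2) by (intro hessian_quadratic_form[where S = "(\<lambda>w. (x0, w)) -` W" and g' = "\<lambda>w. R (Q' (x0, w))"]) auto
  then obtain m where m: "0 < m" "\<And>v. m * (norm v)\<^sup>2 \<le> q (x0, u0) v v"
    using pos_quadratic_form_uniform[of "q (x0, u0)"] pd unfolding pos_definite_def by auto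
  have "continuous_on W q"
    unfolding q_def
    by (intro bounded_bilinear.continuous_on[OF bounded_bilinear_blinfun_compose] continuous_intros cont)
  then have "isCont q (x0, u0)" using W continuous_on_eq_continuous_at by blast
  then obtain d where d: "0 < d" "\<And>z. dist z (x0, u0) < d \<Longrightarrow> dist (q z) (q (x0, u0)) < m"
    using m(1) unfolding continuous_at_eps_delta by blast
  obtain d' where d': "0 < d'" "ball (x0, u0) d' \<subseteq> W" using W open_contains_ball by blast
  \<comment> \<open>The distance in the product is at most the sum of the two coordinate distances,
    hence the factor 2. The bound \<open>d\<close> controls the change of \<open>q\<close>, and
    \<open>d'\<close> keeps the points in \<open>W\<close>.\<close>
  define r where "r = min d d' / 2"
  have near: "dist (x, u) (x0, u0) < min d d'" if "x \<in> ball x0 r" "u \<in> ball u0 r" for x u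
  proof -
    have "dist (x, u) (x0, u0) \<le> dist x x0 + dist u u0"
      unfolding dist_Pair_Pair by (intro sqrt_sum_squares_le_sum) auto
    then show ?thesis using that by (auto simp: r_def dist_commute)
  qed
  have inW: "(x, u) \<in> W" if "x \<in> ball x0 r" "u \<in> ball u0 r" for x u
    using near[OF that] d'(2) by (auto simp: subset_iff dist_commute)
  have nonneg: "0 \<le> Q'' (x, u) (0, v) (0, v)" if "x \<in> ball x0 r" "u \<in> ball u0 r" for x u v
  proof -
    have "q (x0, u0) v v - q (x, u) v v = (q (x0, u0) - q (x, u)) v v"
      by (simp add: blinfun.diff_left)
    also have "\<dots> \<le> norm ((q (x0, u0) - q (x, u)) v) * norm v"
      using norm_blinfun[of "(q (x0, u0) - q (x, u)) v" v] by simp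
    also have "\<dots> \<le> norm (q (x0, u0) - q (x, u)) * norm v * norm v"
      by (intro mult_right_mono norm_blinfun) simp
    also have "\<dots> \<le> m * norm v * norm v"
      using d(2)[of "(x, u)"] near[OF that] by (intro mult_right_mono) (auto simp: dist_norm norm_minus_commute)
    finally show ?thesis using m(2)[of v] by (simp add: q power2_eq_square)
  qed
  have "convex_on (ball u0 r) (Q x)" if x: "x \<in> ball x0 r" for x
  proof (rule convex_on_segmentsI)
    fix u w assume uw: "u \<in> ball u0 r" "w \<in> ball u0 r"
    define z where "z t = (x, u + t *\<^sub>R (w - u))" for t :: real
    have z: "u + t *\<^sub>R (w - u) \<in> ball u0 r" if "t \<in> {0..1}" for t
      using convexD_alt[OF convex_ball uw, of t] that by (simp add: algebra_simps)
    have dz: "(z has_derivative (\<lambda>h. h *\<^sub>R (0, w - u))) (at t)" for t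
    proof -
      have "((\<lambda>t. t *\<^sub>R (w - u)) has_derivative (\<lambda>h. h *\<^sub>R (w - u))) (at t)"
        by (rule bounded_linear_imp_has_derivative) (rule bounded_linear_scaleR_left)
      then have "((\<lambda>t. u + t *\<^sub>R (w - u)) has_derivative (\<lambda>h. 0 + h *\<^sub>R (w - u))) (at t)"
        by (intro has_derivative_add has_derivative_const)
      from has_derivative_Pair[OF has_derivative_const[of x] this] show ?thesis
        by (simp add: z_def[abs_def])
    qed
    show "convex_on {0..1} (\<lambda>t. Q x (u + t *\<^sub>R (w - u)))"
    \<comment> \<open>Along the segment \<open>x\<close> is fixed, so only the direction
      \<open>(0, w - u)\<close> enters, and \<open>nonneg\<close> gives the sign of the second
      derivative.\<close>
    proof (rule f''_ge0_imp_convex[where f' = "\<lambda>t. Q' (z t) (0, w - u)"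
          and f'' = "\<lambda>t. Q'' (z t) (0, w - u) (0, w - u)"])
      fix t :: real assume t: "t \<in> {0..1}"
      note tW = inW[OF x z[OF t], folded z_def]
      have "((\<lambda>t. case z t of (x, u) \<Rightarrow> Q x u) has_real_derivative Q' (z t) (0, w - u)) (at t)"
        using has_derivative_compose[OF dz Q'[OF tW]]
        by (simp only: has_field_derivative_def blinfun.scaleR_right real_scaleR_def mult_commute_abs)
      then show "((\<lambda>t. Q x (u + t *\<^sub>R (w - u))) has_real_derivative Q' (z t) (0, w - u)) (at t)"
        by (simp only: z_def prod.case)
      have "((\<lambda>t. Q' (z t) (0, w - u)) has_derivative (\<lambda>h. Q'' (z t) (h *\<^sub>R (0, w - u)) (0, w - u))) (at t)"
        using bounded_linear.has_derivative[OF blinfun.bounded_linear_left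
            has_derivative_compose[OF dz Q''[OF tW]]] .
      then show "((\<lambda>t. Q' (z t) (0, w - u)) has_real_derivative Q'' (z t) (0, w - u) (0, w - u)) (at t)"
        unfolding has_field_derivative_def
        by (simp only: blinfun.scaleR_right blinfun.scaleR_left real_scaleR_def mult_commute_abs)
      show "0 \<le> Q'' (z t) (0, w - u) (0, w - u)"
        unfolding z_def by (rule nonneg[OF x z[OF t]])
    qed simp
  qed simp
  moreover have "0 < r" using d(1) d'(1) by (simp add: r_def)
  ultimately show thesis using that by blast
qed

text \<open>A short step from \<open>u\<close> towards \<open>w\<close> stays within
  \<open>e\<close> of \<open>u\<close>, and convexity bounds \<open>g\<close> there by a weighted
  mean of \<open>g u\<close> and \<open>g w\<close>. The conclusion does not involve
  \<open>e\<close>, which is how the state-dependent radii of a policy disappear.\<close>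

lemma convex_on_local_min_imp_global_min:
  fixes g :: "'a::real_normed_vector \<Rightarrow> real"
  assumes g: "convex_on C g" and uw: "u \<in> C" "w \<in> C"
    and "0 < e" and min: "\<And>v. v \<in> ball u e \<inter> C \<Longrightarrow> g u \<le> g v"
  shows "g u \<le> g w"
proof (rule ccontr)
  assume less: "\<not> g u \<le> g w"
  then have ne: "0 < norm (w - u)" by auto
  \<comment> \<open>The cap at 1 keeps the point on the segment; the factor 2 makes the step at most
    \<open>e / 2\<close>, strictly inside the open ball.\<close>
  define t where "t = min 1 (e / (2 * norm (w - u)))"
  have t: "0 < t" "t \<le> 1" using ne \<open>0 < e\<close> by (auto simp: t_def)
  have "t * norm (w - u) \<le> e / 2" using ne by (simp add: t_def min_def field_simps)
  then have "norm (t *\<^sub>R (w - u)) < e" using t \<open>0 < e\<close> by simp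
  moreover have "(1 - t) *\<^sub>R u + t *\<^sub>R w = u + t *\<^sub>R (w - u)" by (simp add: algebra_simps)
  moreover have "(1 - t) *\<^sub>R u + t *\<^sub>R w \<in> C"
    using convexD_alt[OF convex_on_imp_convex[OF g] uw, of t] t by simp
  ultimately have "g u \<le> g ((1 - t) *\<^sub>R u + t *\<^sub>R w)"
    by (intro min) (simp add: dist_norm)
  also have "\<dots> \<le> (1 - t) * g u + t * g w"
    using convex_onD[OF g, of t u w] t uw by simp
  finally have "t * g u \<le> t * g w" by (simp add: algebra_simps)
  then show False using t less by simp
qed


section \<open>Locally minimum control policies\<close>

text \<open>Continuity of \<open>p\<close> keeps \<open>p x\<close> in the fixed ball around
  \<open>p x0\<close> on which \<open>Q x\<close> is convex, so \<open>p x\<close> and its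
  competitors \<open>u\<close> lie in one convex set.\<close>

lemma local_min_selection_uniform:
  fixes Q :: "'s::real_normed_vector \<Rightarrow> real^'m \<Rightarrow> real"
  assumes A: "convex A" and Q: "twice_cont_diff_on (\<lambda>(x, u). Q x u) W"
    and W: "open W" "(x0, p x0) \<in> W"
    and pd: "pos_definite (hessian (Q x0) (p x0))"
    and p: "isCont p x0" "\<And>x. p x \<in> A"
    and min: "\<And>x. \<exists>\<epsilon>>0. \<forall>u \<in> ball (p x) \<epsilon> \<inter> A. Q x (p x) \<le> Q x u"
  shows "\<exists>r>0. \<forall>x \<in> ball x0 r. \<forall>u \<in> ball (p x0) r \<inter> A. Q x (p x) \<le> Q x u"
proof -
  obtain r where r: "0 < r" "\<And>x. x \<in> ball x0 r \<Longrightarrow> convex_on (ball (p x0) r) (Q x)"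
    using locally_convex_of_pos_definite_hessian[OF Q W pd] by blast
  obtain d where d: "0 < d" "\<And>x. dist x x0 < d \<Longrightarrow> dist (p x) (p x0) < r"
    using p(1) r(1) unfolding continuous_at_eps_delta by blast
  have "Q x (p x) \<le> Q x u" if x: "x \<in> ball x0 (min d r)" and u: "u \<in> ball (p x0) (min d r) \<inter> A" for x u
  proof -
    obtain \<epsilon> where \<epsilon>: "\<epsilon> > 0" "\<And>u. u \<in> ball (p x) \<epsilon> \<inter> A \<Longrightarrow> Q x (p x) \<le> Q x u"
      using min by blast
    show ?thesis
    proof (rule convex_on_local_min_imp_global_min[where g = "Q x"])
      \<comment> \<open>Intersecting with \<open>A\<close> is essential: \<open>p x\<close> is a
        local minimizer only among points of \<open>A\<close>.\<close>
      show "convex_on (ball (p x0) r \<inter> A) (Q x)"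
        using r(2)[of x] x A by (intro convex_on_subset[OF r(2)] convex_Int) auto
    qed (use x u p d(2)[of x] \<epsilon> in \<open>auto simp: dist_commute\<close>)
  qed
  with d(1) r(1) show ?thesis by (intro exI[of _ "min d r"]) auto
qed

text \<open>The next cost-to-go is smooth only on \<open>S\<close>, so \<open>W\<close> is the
  preimage of \<open>S\<close> under the dynamics of stage \<open>k\<close>.\<close>

lemma twice_cont_diff_Q_fun:
  assumes f: "twice_cont_diff_on (\<lambda>(x, u). f k x u) UNIV"
    and c: "twice_cont_diff_on (\<lambda>(x, u). c k x u) UNIV"
    and S: "open S" "f k x u \<in> S" and J: "twice_cont_diff_on (cost_to_go n f c cT \<pi> (Suc k)) S"
  shows "\<exists>W. open W \<and> (x, u) \<in> W \<and>
    twice_cont_diff_on (\<lambda>(x, u). Q_fun n f c cT \<pi> k x u) W"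
proof (intro exI conjI)
  let ?W = "(\<lambda>(x, u). f k x u) -` S"
  show "open ?W"
    using f S(1) open_vimage twice_cont_diff_on_imp_continuous_on by blast
  show "(x, u) \<in> ?W" using S(2) by simp
  have "twice_cont_diff_on
      (\<lambda>z. (case z of (x, u) \<Rightarrow> c k x u) + cost_to_go n f c cT \<pi> (Suc k) (case z of (x, u) \<Rightarrow> f k x u)) ?W"
    by (intro twice_cont_diff_on_add twice_cont_diff_on_compose[OF J] twice_cont_diff_on_subset[OF f]
        twice_cont_diff_on_subset[OF c]) auto
  then show "twice_cont_diff_on (\<lambda>(x, u). Q_fun n f c cT \<pi> k x u) ?W"
    by (simp add: Q_fun.simps case_prod_beta')
qed

text \<open>Backward induction: the cost-to-go is the Q-function composed with the graph map of
  \<open>\<pi> k\<close>. The dynamics send each induced state to the next one, so local smoothness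
  around the trajectory propagates.\<close>

lemma twice_cont_diff_cost_to_go:
  assumes f: "\<And>k. k < n \<Longrightarrow> twice_cont_diff_on (\<lambda>(x, u). f k x u) UNIV"
    and c: "\<And>k. k < n \<Longrightarrow> twice_cont_diff_on (\<lambda>(x, u). c k x u) UNIV"
    and cT: "twice_cont_diff_on cT UNIV"
    and \<pi>: "\<And>k. k < n \<Longrightarrow>
      \<exists>S. open S \<and> induced_state f \<pi> x0 k \<in> S \<and> twice_cont_diff_on (\<pi> k) S"
    and "k \<le> n"
  shows "\<exists>S. open S \<and> induced_state f \<pi> x0 k \<in> S \<and>
    twice_cont_diff_on (cost_to_go n f c cT \<pi> k) S"
  using \<open>k \<le> n\<close>
proof (induction rule: inc_induct)
  case base
  have "cost_to_go n f c cT \<pi> n = cT" by (simp add: fun_eq_iff cost_to_go.simps)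
  then show ?case using cT by auto
next
  case (step k)
  let ?x = "induced_state f \<pi> x0 k"
  obtain S where "open S" "f k ?x (\<pi> k ?x) \<in> S"
    "twice_cont_diff_on (cost_to_go n f c cT \<pi> (Suc k)) S"
    using step.IH by auto
  from twice_cont_diff_Q_fun[where f = f and c = c, OF f c this] step.hyps
  obtain W where W: "open W" "(?x, \<pi> k ?x) \<in> W"
    "twice_cont_diff_on (\<lambda>(x, u). Q_fun n f c cT \<pi> k x u) W"
    by blast
  obtain T where T: "open T" "?x \<in> T" "twice_cont_diff_on (\<pi> k) T"
    using \<pi> step.hyps by blast
  have graph: "twice_cont_diff_on (\<lambda>x. (x, \<pi> k x)) T"
    by (intro twice_cont_diff_on_Pair T twice_cont_diff_on_linear bounded_linear_ident)
  \<comment> \<open>The points where \<open>\<pi> k\<close> is smooth and whose graph point lies in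
    the domain of smoothness of the Q-function.\<close>
  let ?U = "(\<lambda>x. (x, \<pi> k x)) -` W \<inter> T"
  have "twice_cont_diff_on (\<lambda>x. (\<lambda>(x, u). Q_fun n f c cT \<pi> k x u) (x, \<pi> k x)) ?U"
    by (rule twice_cont_diff_on_compose[OF W(3) twice_cont_diff_on_subset[OF graph]]) auto
  then have "twice_cont_diff_on (cost_to_go n f c cT \<pi> k) ?U"
    using step.hyps by (simp add: cost_to_go.simps[abs_def])
  moreover have "open ?U"
    using continuous_on_open_vimage[OF T(1)] twice_cont_diff_on_imp_continuous_on[OF graph] W(1)
    by blast
  ultimately show ?case using W T by (intro exI[of _ ?U]) auto
qed

text \<open>The initial state \<open>y\<close> varies along with the inputs because a perturbed
  input pushes the next state off the trajectory. Continuity of the dynamics at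
  \<open>(x k, u k)\<close> keeps that state within the radius of the induction hypothesis.\<close>

lemma cost_to_go_le_seq_cost:
  fixes f :: "nat \<Rightarrow> 's::metric_space \<Rightarrow> 'u::metric_space \<Rightarrow> 's"
    and \<pi> :: "nat \<Rightarrow> 's \<Rightarrow> 'u" and x0 :: 's
  defines "x \<equiv> induced_state f \<pi> x0" and "u \<equiv> induced_input f \<pi> x0"
  assumes J: "\<And>k. k < n \<Longrightarrow> \<exists>r>0. \<forall>y \<in> ball (x k) r. \<forall>v \<in> ball (u k) r \<inter> A.
      cost_to_go n f c cT \<pi> k y \<le> Q_fun n f c cT \<pi> k y v"
    and f: "\<And>k. k < n \<Longrightarrow> isCont (\<lambda>(x, u). f k x u) (x k, u k)"
    and "k \<le> n"
  shows "\<exists>\<epsilon>>0. \<forall>y \<in> ball (x k) \<epsilon>. \<forall>vs.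
    length vs = n - k \<and> (\<forall>i<n - k. vs ! i \<in> ball (u (k + i)) \<epsilon> \<inter> A) \<longrightarrow>
      cost_to_go n f c cT \<pi> k y \<le> seq_cost f c cT k y vs"
  using \<open>k \<le> n\<close>
proof (induction rule: inc_induct)
  case base
  \<comment> \<open>No inputs remain and both sides equal \<open>cT y\<close>, so any radius works;
    1 is chosen.\<close>
  show ?case by (auto simp: cost_to_go.simps intro: exI[of _ 1])
next
  case (step k)
  obtain \<epsilon> where \<epsilon>: "\<epsilon> > 0" and IH: "\<And>y vs. y \<in> ball (x (Suc k)) \<epsilon> \<Longrightarrow> length vs = n - Suc k \<Longrightarrow>
      (\<And>i. i < n - Suc k \<Longrightarrow> vs ! i \<in> ball (u (Suc k + i)) \<epsilon> \<inter> A) \<Longrightarrow>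
      cost_to_go n f c cT \<pi> (Suc k) y \<le> seq_cost f c cT (Suc k) y vs"
    using step.IH by blast
  obtain r where r: "r > 0" "\<And>y v. y \<in> ball (x k) r \<Longrightarrow> v \<in> ball (u k) r \<inter> A \<Longrightarrow>
      cost_to_go n f c cT \<pi> k y \<le> Q_fun n f c cT \<pi> k y v"
    using J step.hyps by blast
  obtain d where d: "d > 0"
    "\<And>z. dist z (x k, u k) < d \<Longrightarrow> dist ((\<lambda>(x, u). f k x u) z) (f k (x k) (u k)) < \<epsilon>"
    using f[OF step.hyps(2)] \<epsilon> unfolding continuous_at_eps_delta by (metis case_prod_conv)
  have xS: "x (Suc k) = f k (x k) (u k)" by (simp add: x_def u_def induced_input_def)
  \<comment> \<open>\<open>d / 2\<close> bounds the displacement of the pair \<open>(y, v)\<close>,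
    \<open>r\<close> allows the one-stage inequality, and \<open>\<epsilon>\<close> serves the
    remaining inputs.\<close>
  define e where "e = min (d / 2) (min r \<epsilon>)"
  have "cost_to_go n f c cT \<pi> k y \<le> seq_cost f c cT k y vs"
    if y: "y \<in> ball (x k) e" and len: "length vs = n - k"
      and vs: "\<forall>i<n - k. vs ! i \<in> ball (u (k + i)) e \<inter> A" for y vs
  proof -
    obtain v ws where vw: "vs = v # ws" using len step.hyps by (cases vs) auto
    have v: "v \<in> ball (u k) e \<inter> A" using vs[rule_format, of 0] step.hyps vw by simp
    \<comment> \<open>Position \<open>i\<close> of the tail is position \<open>Suc i\<close> of
      \<open>vs\<close>; both refer to stage \<open>Suc k + i\<close>.\<close>
    have ws: "ws ! i \<in> ball (u (Suc k + i)) \<epsilon> \<inter> A" if "i < n - Suc k" for i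
      using vs[rule_format, of "Suc i"] that vw by (auto simp: e_def)
    have "dist (y, v) (x k, u k) \<le> dist y (x k) + dist v (u k)"
      unfolding dist_Pair_Pair by (intro sqrt_sum_squares_le_sum) auto
    also have "\<dots> < d" using y v by (auto simp: e_def dist_commute)
    finally have "f k y v \<in> ball (x (Suc k)) \<epsilon>"
      using d(2)[of "(y, v)"] by (simp add: xS dist_commute)
    then have "cost_to_go n f c cT \<pi> (Suc k) (f k y v) \<le> seq_cost f c cT (Suc k) (f k y v) ws"
      using len vw ws by (intro IH) auto
    moreover have "cost_to_go n f c cT \<pi> k y \<le> Q_fun n f c cT \<pi> k y v"
      using y v by (intro r) (auto simp: e_def)
    ultimately show ?thesis by (simp add: vw Q_fun.simps)
  qed
  moreover have "e > 0" using d r \<epsilon> by (simp add: e_def)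
  ultimately show ?case by blast
qed

text \<open>Both recursions collect the same stage costs along the induced trajectory. The case
  \<open>k = 0\<close> lets spuriousness pass from the policy to its inputs.\<close>

lemma seq_cost_induced_inputs:
  "k \<le> n \<Longrightarrow> seq_cost f c cT k (induced_state f \<pi> x0 k) (map (induced_input f \<pi> x0) [k..<n]) =
    cost_to_go n f c cT \<pi> k (induced_state f \<pi> x0 k)"
proof (induction rule: inc_induct)
  case base
  show ?case by (simp add: cost_to_go.simps)
next
  case (step k)
  then show ?case
    \<comment> \<open>Unfolding is restricted to stage \<open>k\<close>, so that the cost-to-go at
      \<open>Suc k\<close> keeps the form found in the induction hypothesis.\<close>
    by (simp add: upt_conv_Cons induced_input_def cost_to_go.simps[of _ _ _ _ _ k] Q_fun.simps)
qed

theorem theorem1: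
  fixes n :: nat
    and A :: "(real^'M) set"
    and f :: "nat \<Rightarrow> real^'N \<Rightarrow> real^'M \<Rightarrow> real^'N"
    and c :: "nat \<Rightarrow> real^'N \<Rightarrow> real^'M \<Rightarrow> real"
    and cT :: "real^'N \<Rightarrow> real"
    and x0 :: "real^'N"
    and \<pi> :: "nat \<Rightarrow> real^'N \<Rightarrow> real^'M"
  assumes "compact A" and "convex A"
    and "\<And>k. k < n \<Longrightarrow> twice_cont_diff_on (\<lambda>(x, u). f k x u) UNIV"
    and "\<And>k. k < n \<Longrightarrow> twice_cont_diff_on (\<lambda>(x, u). c k x u) UNIV"
    and "twice_cont_diff_on cT UNIV"
    and "locally_min_policy n A f c cT \<pi>"
    and "\<And>k. k < n \<Longrightarrow>
      \<exists>S. open S \<and> induced_state f \<pi> x0 k \<in> S \<and> twice_cont_diff_on (\<pi> k) S"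
    and "\<And>k. k < n \<Longrightarrow>
      pos_definite (hessian (Q_fun n f c cT \<pi> k (induced_state f \<pi> x0 k)) (induced_input f \<pi> x0 k))"
  shows "one_shot_local_min n A f c cT x0 (induced_inputs n f \<pi> x0) \<and>
    (spurious_locally_min_policy n A f c cT x0 \<pi> \<longrightarrow>
      spurious_one_shot_local_min n A f c cT x0 (induced_inputs n f \<pi> x0))"
proof -
  let ?x = "induced_state f \<pi> x0" and ?u = "induced_input f \<pi> x0"
  have pol: "\<And>k x. k < n \<Longrightarrow> \<pi> k x \<in> A"
    and min: "\<And>k x. k < n \<Longrightarrow> \<exists>\<epsilon>>0. \<forall>u \<in> ball (\<pi> k x) \<epsilon> \<inter> A.
      Q_fun n f c cT \<pi> k x (\<pi> k x) \<le> Q_fun n f c cT \<pi> k x u"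
    using assms(6) unfolding locally_min_policy_def control_policy_def by blast+
  have J: "\<exists>r>0. \<forall>y \<in> ball (?x k) r. \<forall>v \<in> ball (?u k) r \<inter> A.
      cost_to_go n f c cT \<pi> k y \<le> Q_fun n f c cT \<pi> k y v" if k: "k < n" for k
  proof -
    obtain S where S: "open S" "f k (?x k) (?u k) \<in> S"
      "twice_cont_diff_on (cost_to_go n f c cT \<pi> (Suc k)) S"
      \<comment> \<open>Smoothness is taken at stage \<open>Suc k\<close>, whose cost-to-go enters
        the Q-function of stage \<open>k\<close>; \<open>Suc k\<close> may equal \<open>n\<close>,
        the terminal stage.\<close>
      using twice_cont_diff_cost_to_go[where n = n and f = f and c = c, OF assms(3-5) assms(7), of "Suc k"] k
      by (auto simp: induced_input_def)
    obtain W where W: "open W" "(?x k, ?u k) \<in> W"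
      "twice_cont_diff_on (\<lambda>(x, u). Q_fun n f c cT \<pi> k x u) W"
      using twice_cont_diff_Q_fun[where n = n and f = f and c = c, OF assms(3)[OF k] assms(4)[OF k] S] by blast
    have "isCont (\<pi> k) (?x k)"
      using assms(7)[OF k] continuous_on_eq_continuous_at twice_cont_diff_on_imp_continuous_on
      by blast
    from local_min_selection_uniform[OF assms(2) W(3,1) _ _ this pol[OF k] min[OF k]] W(2) assms(8)[OF k]
    show ?thesis using k by (simp add: cost_to_go.simps[of _ _ _ _ _ k] induced_input_def)
  qed
  have f: "isCont (\<lambda>(x, u). f k x u) (?x k, ?u k)" if "k < n" for k
    using twice_cont_diff_on_imp_continuous_on[OF assms(3)[OF that]]
    by (simp add: continuous_on_eq_continuous_at)
  have cost: "seq_cost f c cT 0 x0 (induced_inputs n f \<pi> x0) = cost_to_go n f c cT \<pi> 0 x0"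
    using seq_cost_induced_inputs[of 0 n f c cT \<pi> x0] by (simp add: induced_inputs_def)
  obtain \<epsilon> where \<epsilon>: "\<epsilon> > 0" "\<And>vs. length vs = n \<Longrightarrow> (\<forall>i<n. vs ! i \<in> ball (?u i) \<epsilon> \<inter> A) \<Longrightarrow>
      cost_to_go n f c cT \<pi> 0 x0 \<le> seq_cost f c cT 0 x0 vs"
    \<comment> \<open>The perturbed initial state is specialized to \<open>x0\<close>, the center of
      its ball.\<close>
    using cost_to_go_le_seq_cost[of n f \<pi> x0 A c cT 0, OF J f] by auto
  have "induced_inputs n f \<pi> x0 \<in> input_seqs n A"
    using pol by (auto simp: induced_inputs_def input_seqs_def induced_input_def)
  moreover have "\<forall>vs. length vs = n \<and> (\<forall>i<n. vs ! i \<in> ball (induced_inputs n f \<pi> x0 ! i) \<epsilon> \<inter> A) \<longrightarrow>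
      seq_cost f c cT 0 x0 (induced_inputs n f \<pi> x0) \<le> seq_cost f c cT 0 x0 vs"
    using \<epsilon>(2) by (simp add: cost) (simp add: induced_inputs_def)
  ultimately have "one_shot_local_min n A f c cT x0 (induced_inputs n f \<pi> x0)"
    unfolding one_shot_local_min_def using \<epsilon>(1) by blast
  \<comment> \<open>Both notions of spuriousness compare with the same \<open>opt_value\<close>, and
    by \<open>cost\<close> the compared values coincide.\<close>
  then show ?thesis
    unfolding spurious_locally_min_policy_def spurious_one_shot_local_min_def by (simp add: cost)
qed

end
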